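(* Let $0<q<1$ and let $b$ be a positive integer. For every $s\in\mathbb{C}$ with $\Re(s)>b$, the function $G_q^{(0,b)}(s)$ (defined below) satisfies \[ G_q^{(0,b)}(s)=\zeta_q(s). \]
   Context: Fix $0<q<1$ and for a positive integer $m$ put $[m]_q=\frac{1-q^m}{1-q}$. The $q$-multiple zeta function is \[ \zeta_q(s_1,\ldots,s_r)=\sum_{0<n_1<\cdots<n_r}\prod_{j=1}^r\frac{q^{(s_j-1)n_j}}{[n_j]_q^{s_j}},\qquad s_j\in\mathbb{C}, \] absolutely convergent on $\{\Re(s_{r-k+1}+\cdots+s_r)>k,\ k=1,\ldots,r\}$ and extended to $\mathbb{C}^r$ by meromorphic continuation. For a non-negative integer $a$, a positive integer $b$, and complex $s_1,\ldots,s_a,s$ with $\Re(s)>b$ and $\Re(s+s_{a-k+1}+\cdots+s_a)>k+b$ for $k=1,\ldots,a$, define inductively \[ G_q^{(a,1)}(s_1,\ldots,s_a;s)=\zeta_q(s_1,\ldots,s_a,s), \] \[ G_q^{(a,b)}(s_1,\ldots,s_a;s)=\sum_{n=0}^\infty G_q^{(a+1,b-1)}(s_1,\ldots,s_a,s-n-b;\,n+b)-\sum_{n=0}^\infty G_q^{(a+1,b-1)}(s_1,\ldots,s_a,-n;\,s+n)\quad(b\ge 2). \] Thus $G_q^{(0,b)}(s)$ is the case $a=0$ (no variables before the semicolon). *)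

theory Defs
  imports "HOL-Analysis.Analysis"
begin

definition q_int :: "real \<Rightarrow> nat \<Rightarrow> real" where
  "q_int q m = (1 - q ^ m) / (1 - q)"

text \<open>The variables \<open>s\<^sub>1, \<dots>, s\<^sub>r\<close> form a list, so the depth \<open>r\<close> is its length; the condition
  \<open>sorted_wrt (<) (0 # ns)\<close> says \<open>0 < n\<^sub>1 < \<dots> < n\<^sub>r\<close>. The series represents the
  \<open>q\<close>-multiple zeta function on its region of absolute convergence
  \<open>Re (s\<^bsub>r-k+1\<^esub> + \<dots> + s\<^sub>r) > k\<close> for \<open>1 \<le> k \<le> r\<close>. The continuation is not needed below,
  because only values in this region enter \<open>G_q\<close> on its domain.\<close>

definition zeta_q :: "real \<Rightarrow> complex list \<Rightarrow> complex" where
  "zeta_q q ss =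
     (\<Sum>\<^sub>\<infinity>ns\<in>{ns :: nat list. length ns = length ss \<and> sorted_wrt (<) (0 # ns)}.
        \<Prod>j<length ss.
          complex_of_real q powr ((ss ! j - 1) * of_nat (ns ! j)) /
          complex_of_real (q_int q (ns ! j)) powr (ss ! j))"

text \<open>\<open>G_q q b [s\<^sub>1, \<dots>, s\<^sub>a] s\<close> is \<open>G\<^sub>q\<^bsup>(a,b)\<^esup>(s\<^sub>1, \<dots>, s\<^sub>a; s)\<close>; \<open>a\<close> is the length of the list
  and the index \<open>b \<ge> 2\<close> of the recursion is \<open>Suc (Suc c)\<close>. It is meaningful for
  \<open>Re s > b\<close> and \<open>Re (s + s\<^bsub>a-k+1\<^esub> + \<dots> + s\<^sub>a) > k + b\<close>, \<open>1 \<le> k \<le> a\<close>. The recursive calls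
  stay inside these domains, and for \<open>b = 1\<close> the domain is exactly the region of
  absolute convergence of the series \<open>zeta_q\<close> in depth \<open>a + 1\<close>. The value for \<open>b = 0\<close> is
  left unspecified.\<close>

fun G_q :: "real \<Rightarrow> nat \<Rightarrow> complex list \<Rightarrow> complex \<Rightarrow> complex" where
  "G_q q (Suc 0) ss s = zeta_q q (ss @ [s])"
| "G_q q (Suc (Suc c)) ss s =
     (\<Sum>n. G_q q (Suc c) (ss @ [s - of_nat n - of_nat (Suc (Suc c))])
                          (of_nat n + of_nat (Suc (Suc c)))) -
     (\<Sum>n. G_q q (Suc c) (ss @ [- of_nat n]) (s + of_nat n))"

end

theory Submission
  imports Defs
begin

text \<open>Put \<open>x\<^sub>n = q\<^sup>n / [n]\<^sub>q\<close>, so that the summand of \<open>\<zeta>\<^sub>q\<close> is \<open>q\<^bsup>-n\<^esup> x\<^sub>n\<^sup>s\<close>, and let \<open>h\<^sub>k(i, j)\<close> be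
  the complete homogeneous symmetric polynomial of degree \<open>k\<close> in \<open>x\<^sub>i, \<dots>, x\<^sub>j\<close>. By induction on
  \<open>b\<close>, \<open>G\<^sub>q\<^bsup>(a,b)\<^esup>(s\<^sub>1, \<dots>, s\<^sub>a; s)\<close> is the sum over \<open>0 < n\<^sub>1 < \<dots> < n\<^sub>a < m\<close> of the summands for
  \<open>s\<^sub>1, \<dots>, s\<^sub>a\<close> times \<open>q\<^bsup>-m\<^esup> x\<^sub>m\<^bsup>s-b+1\<^esup> h\<^bsub>b-1\<^esub>(m - n\<^sub>a, m)\<close>. In the induction step the series over \<open>n\<close> are
  geometric in \<open>x\<^sub>M / x\<^sub>m\<close>, where \<open>M > m\<close> are the two largest indices, and sum up to the factors
  \<open>x\<^bsub>M-m\<^esub> - x\<^sub>M\<close> and \<open>x\<^bsub>M-m\<^esub>\<close>. These telescope against \<open>h\<^bsub>b-2\<^esub>(M - m, M)\<close>: the first double series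
  becomes a sum over \<open>m\<close> with coefficient \<open>h\<^bsub>b-1\<^esub>(1, m)\<close>, the second a sum over \<open>M\<close> with coefficient
  \<open>h\<^bsub>b-1\<^esub>(1, M) - h\<^bsub>b-1\<^esub>(M - n\<^sub>a, M)\<close>. For \<open>a = 0\<close>, where \<open>n\<^sub>0 = 0\<close>, the
  remaining factor \<open>h\<^bsub>b-1\<^esub>(m, m)\<close> is \<open>x\<^sub>m\<^bsup>b-1\<^esup>\<close>.\<close>

section \<open>Weighted infinite sums\<close>

lemma abs_summable_on_scaleR_bounded:
  fixes f :: "'a \<Rightarrow> 'b :: real_normed_vector"
  assumes "(\<lambda>x. norm (f x)) summable_on A" and "\<And>x. x \<in> A \<Longrightarrow> \<bar>g x\<bar> \<le> C"
  shows "(\<lambda>x. norm (g x *\<^sub>R f x)) summable_on A"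
proof (rule Infinite_Sum.abs_summable_on_comparison_test')
  show "(\<lambda>x. C * norm (f x)) summable_on A"
    using assms(1) by (rule summable_on_cmult_right)
  show "norm (g x *\<^sub>R f x) \<le> C * norm (f x)" if "x \<in> A" for x
    using assms(2)[OF that] by (simp add: mult_right_mono)
qed

lemma abs_summable_on_Sigma_scaleR:
  fixes f :: "'a \<Rightarrow> 'c :: real_normed_vector" and k :: "'a \<Rightarrow> 'b \<Rightarrow> real"
  assumes k: "\<And>x. x \<in> A \<Longrightarrow> (k x has_sum g x) (B x)"
    and nonneg: "\<And>x y. x \<in> A \<Longrightarrow> y \<in> B x \<Longrightarrow> k x y \<ge> 0"
    and summable: "(\<lambda>x. norm (g x *\<^sub>R f x)) summable_on A"
  shows "(\<lambda>(x, y). norm (k x y *\<^sub>R f x)) summable_on Sigma A B"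
proof (rule summable_on_SigmaI[OF _ summable])
  fix x assume x: "x \<in> A"
  have "g x \<ge> 0"
    using has_sum_nonneg[OF k[OF x]] nonneg[OF x] by blast
  have "((\<lambda>y. k x y * norm (f x)) has_sum g x * norm (f x)) (B x)"
    by (intro has_sum_cmult_left k x)
  also have "?this \<longleftrightarrow> ((\<lambda>y. norm (k x y *\<^sub>R f x)) has_sum g x * norm (f x)) (B x)"
    using nonneg[OF x] by (intro has_sum_cong) auto
  finally show "((\<lambda>y. case (x, y) of (x, y) \<Rightarrow> norm (k x y *\<^sub>R f x)) has_sum norm (g x *\<^sub>R f x)) (B x)"
    using \<open>g x \<ge> 0\<close> by simp
qed auto

lemma has_sum_Sigma_scaleR:
  fixes f :: "'a \<Rightarrow> 'c :: banach" and k :: "'a \<Rightarrow> 'b \<Rightarrow> real"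
  assumes k: "\<And>x. x \<in> A \<Longrightarrow> (k x has_sum g x) (B x)"
    and nonneg: "\<And>x y. x \<in> A \<Longrightarrow> y \<in> B x \<Longrightarrow> k x y \<ge> 0"
    and summable: "(\<lambda>x. norm (g x *\<^sub>R f x)) summable_on A"
  shows "((\<lambda>(x, y). k x y *\<^sub>R f x) has_sum (\<Sum>\<^sub>\<infinity>x\<in>A. g x *\<^sub>R f x)) (Sigma A B)"
proof (rule has_sum_SigmaI)
  show "((\<lambda>y. case (x, y) of (x, y) \<Rightarrow> k x y *\<^sub>R f x) has_sum g x *\<^sub>R f x) (B x)" if "x \<in> A" for x
    using has_sum_bounded_linear[OF bounded_linear_scaleR_left k[OF that]] by simp
  show "((\<lambda>x. g x *\<^sub>R f x) has_sum (\<Sum>\<^sub>\<infinity>x\<in>A. g x *\<^sub>R f x)) A"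
    using abs_summable_summable[OF summable] by (rule has_sum_infsum)
  show "(\<lambda>(x, y). k x y *\<^sub>R f x) summable_on Sigma A B"
  proof (rule abs_summable_summable)
    have "(\<lambda>(x, y). norm (k x y *\<^sub>R f x)) summable_on Sigma A B"
      using assms by (rule abs_summable_on_Sigma_scaleR)
    then show "(\<lambda>z. norm (case z of (x, y) \<Rightarrow> k x y *\<^sub>R f x)) summable_on Sigma A B"
      by (simp add: case_prod_unfold)
  qed
qed

lemma has_sum_imp_sums_infsum_snd:
  fixes f :: "'a \<times> nat \<Rightarrow> 'c :: banach"
  assumes "(f has_sum S) (A \<times> UNIV)"
  shows "(\<lambda>n. \<Sum>\<^sub>\<infinity>x\<in>A. f (x, n)) sums S"
proof (rule has_sum_imp_sums, rule has_sum_SigmaD)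
  show "((\<lambda>(n, x). f (x, n)) has_sum S) (UNIV \<times> A)"
    using assms by (subst (asm) has_sum_swap) (simp add: case_prod_unfold)
  show "((\<lambda>x. case (n, x) of (n, x) \<Rightarrow> f (x, n)) has_sum (\<Sum>\<^sub>\<infinity>x\<in>A. f (x, n))) A" for n
  proof -
    have "f summable_on A \<times> {n}"
      using has_sum_imp_summable[OF assms] by (rule summable_on_subset_banach) auto
    also have "A \<times> {n} = (\<lambda>x. (x, n)) ` A"
      by auto
    finally have "(\<lambda>x. f (x, n)) summable_on A"
      by (simp add: summable_on_reindex inj_on_def o_def)
    then show ?thesis by simp
  qed
qed

lemma sums_infsum_Sigma_scaleR:
  fixes f :: "'a \<Rightarrow> 'c :: banach" and u :: "'a \<Rightarrow> 'b \<Rightarrow> nat \<Rightarrow> real"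
  assumes u: "\<And>x y. x \<in> A \<Longrightarrow> y \<in> B x \<Longrightarrow> u x y sums k x y"
    and nonneg: "\<And>x y n. x \<in> A \<Longrightarrow> y \<in> B x \<Longrightarrow> u x y n \<ge> 0"
    and k: "\<And>x. x \<in> A \<Longrightarrow> (k x has_sum g x) (B x)"
    and summable: "(\<lambda>x. norm (g x *\<^sub>R f x)) summable_on A"
  shows "(\<lambda>n. \<Sum>\<^sub>\<infinity>(x, y)\<in>Sigma A B. u x y n *\<^sub>R f x) sums (\<Sum>\<^sub>\<infinity>x\<in>A. g x *\<^sub>R f x)"
proof -
  have k_nonneg: "k x y \<ge> 0" if "x \<in> A" "y \<in> B x" for x y
    using sums_le[OF _ sums_zero u] nonneg that by simp
  have "((\<lambda>(z, n). u (fst z) (snd z) n *\<^sub>R f (fst z)) has_sum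
      (\<Sum>\<^sub>\<infinity>z\<in>Sigma A B. k (fst z) (snd z) *\<^sub>R f (fst z))) (Sigma A B \<times> UNIV)"
    using u nonneg abs_summable_on_Sigma_scaleR[OF k k_nonneg summable]
    by (intro has_sum_Sigma_scaleR sums_nonneg_imp_has_sum) (auto simp: case_prod_unfold)
  moreover have "(\<Sum>\<^sub>\<infinity>z\<in>Sigma A B. k (fst z) (snd z) *\<^sub>R f (fst z)) = (\<Sum>\<^sub>\<infinity>x\<in>A. g x *\<^sub>R f x)"
    using infsumI[OF has_sum_Sigma_scaleR[OF k k_nonneg summable]] by (simp add: case_prod_unfold)
  ultimately show ?thesis
    using has_sum_imp_sums_infsum_snd by (fastforce simp: case_prod_unfold)
qed

lemma has_sum_geometric_greaterThan:
  fixes c :: "'a :: {real_normed_field, banach}"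
  assumes "norm c < 1"
  shows "((\<lambda>n. c ^ n) has_sum (c / (1 - c) * c ^ N)) {N<..}"
proof -
  have "((\<lambda>n. c ^ n * c ^ N) has_sum (c / (1 - c) * c ^ N)) {1..}"
    by (intro has_sum_cmult_left has_sum_geometric_from_1 assms)
  also have "?this \<longleftrightarrow> ?thesis"
    by (rule has_sum_reindex_bij_witness[where i = "\<lambda>n. n - N" and j = "\<lambda>n. n + N"])
      (auto simp: power_add)
  finally show ?thesis .
qed

section \<open>Complete homogeneous symmetric polynomials\<close>

fun complete_hom :: "(nat \<Rightarrow> 'a :: comm_semiring_1) \<Rightarrow> nat \<Rightarrow> nat \<Rightarrow> nat \<Rightarrow> 'a" where
  complete_hom_0: "complete_hom x 0 i j = 1"
| complete_hom_Suc: "complete_hom x (Suc k) i j = (\<Sum>l=i..j. x l * complete_hom x k l j)"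

declare complete_hom_Suc [simp del]

lemma complete_hom_lower:
  assumes "i \<le> j"
  shows "complete_hom x (Suc k) i j = x i * complete_hom x k i j + complete_hom x (Suc k) (Suc i) j"
  using assms by (simp add: complete_hom_Suc sum.atLeast_Suc_atMost)

lemma complete_hom_upper:
  assumes "i \<le> Suc j"
  shows "complete_hom x (Suc k) i (Suc j) =
    complete_hom x (Suc k) i j + x (Suc j) * complete_hom x k i (Suc j)"
  using assms
proof (induction k arbitrary: i)
  case 0
  then show ?case by (simp add: complete_hom_Suc)
next
  case (Suc k)
  have "complete_hom x (Suc (Suc k)) i (Suc j) = (\<Sum>l=i..Suc j. x l * complete_hom x (Suc k) l (Suc j))"
    by (rule complete_hom_Suc)
  also have "\<dots> =
      (\<Sum>l=i..Suc j. x l * (complete_hom x (Suc k) l j + x (Suc j) * complete_hom x k l (Suc j)))"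
    using Suc.IH by (intro sum.cong) auto
  also have "\<dots> = (\<Sum>l=i..Suc j. x l * complete_hom x (Suc k) l j) +
      x (Suc j) * complete_hom x (Suc k) i (Suc j)"
    by (simp add: complete_hom_Suc algebra_simps sum.distrib sum_distrib_left del: sum.cl_ivl_Suc)
  also have "(\<Sum>l=i..Suc j. x l * complete_hom x (Suc k) l j) = complete_hom x (Suc (Suc k)) i j"
    using Suc.prems by (simp add: complete_hom_Suc)
  finally show ?case .
qed

lemma complete_hom_shift_diff:
  fixes x :: "nat \<Rightarrow> 'a :: comm_ring_1"
  assumes "i \<le> Suc j"
  shows "complete_hom x (Suc k) i j - complete_hom x (Suc k) (Suc i) (Suc j) =
    (x i - x (Suc j)) * complete_hom x k i (Suc j)"
  using complete_hom_upper[OF assms, of x k] complete_hom_lower[OF assms, of x k]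
  by (simp add: algebra_simps)

lemma complete_hom_singleton: "complete_hom x k i i = x i ^ k"
  by (induction k) (simp_all add: complete_hom_Suc)

lemma complete_hom_nonneg:
  fixes x :: "nat \<Rightarrow> 'a :: linordered_idom"
  assumes "\<And>l. x l \<ge> 0"
  shows "complete_hom x k i j \<ge> 0"
  by (induction k arbitrary: i)
    (auto simp: complete_hom_Suc intro!: sum_nonneg mult_nonneg_nonneg assms)

lemma complete_hom_le_sum_power:
  fixes x :: "nat \<Rightarrow> 'a :: linordered_idom"
  assumes nonneg: "\<And>l. x l \<ge> 0"
  shows "complete_hom x k i j \<le> (\<Sum>l=i..j. x l) ^ k"
proof (induction k arbitrary: i)
  case (Suc k)
  have "complete_hom x (Suc k) i j \<le> (\<Sum>l=i..j. x l * (\<Sum>l=i..j. x l) ^ k)"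
    unfolding complete_hom_Suc
  proof (intro sum_mono mult_left_mono nonneg)
    fix l assume "l \<in> {i..j}"
    have "complete_hom x k l j \<le> (\<Sum>l=l..j. x l) ^ k"
      by (rule Suc.IH)
    also have "\<dots> \<le> (\<Sum>l=i..j. x l) ^ k"
      using \<open>l \<in> {i..j}\<close> nonneg by (intro power_mono sum_mono2 sum_nonneg) auto
    finally show "complete_hom x k l j \<le> (\<Sum>l=i..j. x l) ^ k" .
  qed
  then show ?case
    by (simp add: sum_distrib_right)
qed simp

section \<open>Increasing lists\<close>

definition increasing_lists :: "nat \<Rightarrow> nat \<Rightarrow> nat list set" where
  "increasing_lists N r = {ns. length ns = r \<and> sorted_wrt (<) (N # ns)}"

lemma increasing_lists_0: "increasing_lists N 0 = {[]}"
  by (auto simp: increasing_lists_def)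

lemma length_increasing_lists: "ns \<in> increasing_lists N r \<Longrightarrow> length ns = r"
  by (simp add: increasing_lists_def)

lemma bij_betw_increasing_lists_Cons:
  "bij_betw (\<lambda>(n, ns). n # ns) (SIGMA n:{N<..}. increasing_lists n r) (increasing_lists N (Suc r))"
proof (rule bij_betwI[where g = "\<lambda>ns. (hd ns, tl ns)"])
  show "(\<lambda>(n, ns). n # ns) \<in> (SIGMA n:{N<..}. increasing_lists n r) \<rightarrow> increasing_lists N (Suc r)"
    by (force simp: increasing_lists_def)
qed (auto simp: increasing_lists_def length_Suc_conv)

lemma snoc_mem_increasing_lists_iff:
  "ns @ [m] \<in> increasing_lists N (Suc r) \<longleftrightarrow> ns \<in> increasing_lists N r \<and> last (N # ns) < m"
proof -
  have "sorted_wrt (<) (xs @ [m]) \<longleftrightarrow> sorted_wrt (<) xs \<and> last xs < m" if "xs \<noteq> []" for xs :: "nat list"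
    using that by (induction xs rule: rev_induct) (auto simp: sorted_wrt_append)
  from this[of "N # ns"] show ?thesis
    by (auto simp: increasing_lists_def)
qed

lemma bij_betw_increasing_lists_snoc:
  "bij_betw (\<lambda>(ns, m). ns @ [m]) (SIGMA ns:increasing_lists N r. {last (N # ns)<..})
    (increasing_lists N (Suc r))"
  unfolding bij_betw_def
proof
  show "inj_on (\<lambda>(ns, m). ns @ [m]) (SIGMA ns:increasing_lists N r. {last (N # ns)<..})"
    by (auto simp: inj_on_def)
  have "ns \<in> (\<lambda>(ns, m). ns @ [m]) ` (SIGMA ns:increasing_lists N r. {last (N # ns)<..})"
    if "ns \<in> increasing_lists N (Suc r)" for ns
  proof (cases ns rule: rev_cases)
    case Nil
    with that show ?thesis by (simp add: increasing_lists_def)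
  next
    case (snoc ms m)
    with that show ?thesis
      by (force simp: snoc_mem_increasing_lists_iff simp del: last.simps)
  qed
  then show "(\<lambda>(ns, m). ns @ [m]) ` (SIGMA ns:increasing_lists N r. {last (N # ns)<..}) =
      increasing_lists N (Suc r)"
    by (auto simp: snoc_mem_increasing_lists_iff simp del: last.simps)
qed

text \<open>Summing over the smallest index last keeps the sum geometric in the lower bound \<open>N\<close>.\<close>

lemma has_sum_geometric_increasing_lists:
  fixes cs :: "real list"
  assumes "\<And>c. c \<in> set cs \<Longrightarrow> c \<ge> 0" and "\<And>j. j < length cs \<Longrightarrow> prod_list (drop j cs) < 1"
  shows "\<exists>C. \<forall>N. ((\<lambda>ns. prod_list (map2 power cs ns)) has_sum (C * prod_list cs ^ N))
    (increasing_lists N (length cs))"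
  using assms
proof (induction cs)
  case Nil
  show ?case
    by (intro exI[of _ 1]) (simp add: increasing_lists_0 has_sum_finiteI)
next
  case (Cons c cs)
  define P where "P = (\<lambda>ns. prod_list (map2 power cs ns))"
  define p where "p = prod_list (c # cs)"
  have P_nonneg: "P ns \<ge> 0" for ns
    unfolding P_def using Cons.prems(1) by (intro prod_list_nonneg) (auto dest: set_zip_leftD)
  have p: "0 \<le> p" "p < 1"
    using prod_list_nonneg[of "c # cs"] Cons.prems(1) Cons.prems(2)[of 0] by (auto simp: p_def)
  obtain C where C: "(P has_sum (C * prod_list cs ^ N)) (increasing_lists N (length cs))" for N
    using Cons.IH Cons.prems(1) Cons.prems(2)[of "Suc _"] unfolding P_def by auto
  have inner: "((\<lambda>ns. c ^ n * P ns) has_sum C * p ^ n) (increasing_lists n (length cs))" for n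
    using has_sum_cmult_right[OF C[of n], of "c ^ n"] by (simp add: p_def power_mult_distrib mult_ac)
  have outer: "((\<lambda>n. C * p ^ n) has_sum C * (p / (1 - p) * p ^ N)) {N<..}" for N
    using p by (intro has_sum_cmult_right has_sum_geometric_greaterThan) simp
  have nested: "((\<lambda>(n, ns). c ^ n * P ns) has_sum C * (p / (1 - p) * p ^ N))
      (SIGMA n:{N<..}. increasing_lists n (length cs))" for N
  proof (rule has_sum_SigmaI[OF _ outer])
    show "(\<lambda>(n, ns). c ^ n * P ns) summable_on (SIGMA n:{N<..}. increasing_lists n (length cs))"
      using Cons.prems(1) inner P_nonneg
      by (intro summable_on_SigmaI[OF _ has_sum_imp_summable[OF outer]]) auto
  qed (simp add: inner)
  have "((\<lambda>ns. prod_list (map2 power (c # cs) ns)) has_sum C * (p / (1 - p) * p ^ N))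
      (increasing_lists N (Suc (length cs)))" for N
    using nested[of N]
    by (subst has_sum_reindex_bij_betw[OF bij_betw_increasing_lists_Cons, symmetric])
      (simp add: P_def case_prod_unfold)
  then show ?case
    unfolding p_def by (intro exI[of _ "C * (p / (1 - p))"]) (simp add: p_def mult.assoc)
qed

section \<open>The summands of the \<open>q\<close>-multiple zeta function\<close>

definition q_base :: "real \<Rightarrow> nat \<Rightarrow> real" where
  "q_base q n = q ^ n / q_int q n"

abbreviation q_hom :: "real \<Rightarrow> nat \<Rightarrow> nat \<Rightarrow> nat \<Rightarrow> real" where
  "q_hom q \<equiv> complete_hom (q_base q)"

definition q_term :: "real \<Rightarrow> nat \<Rightarrow> complex \<Rightarrow> complex" where
  "q_term q n s = complex_of_real q powr ((s - 1) * of_nat n) / complex_of_real (q_int q n) powr s"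

definition q_prod :: "real \<Rightarrow> complex list \<Rightarrow> nat list \<Rightarrow> complex" where
  "q_prod q ss ns = prod_list (map2 (\<lambda>s n. q_term q n s) ss ns)"

lemma zeta_q_eq_infsum_q_prod:
  "zeta_q q ss = (\<Sum>\<^sub>\<infinity>ns\<in>increasing_lists 0 (length ss). q_prod q ss ns)"
  unfolding zeta_q_def increasing_lists_def
  by (intro infsum_cong) (simp add: q_prod_def q_term_def prod.list_conv_set_nth atLeast0LessThan)

lemma q_prod_snoc:
  "length ns = length ss \<Longrightarrow> q_prod q (ss @ [s]) (ns @ [m]) = q_prod q ss ns * q_term q m s"
  by (simp add: q_prod_def)

lemma q_int_add: "q_int q (m + n) = q_int q m + q ^ m * q_int q n"
  by (simp add: q_int_def power_add algebra_simps flip: add_divide_distrib)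

context
  fixes q :: real
  assumes q: "0 < q" "q < 1"
begin

lemma q_int_nonneg: "q_int q n \<ge> 0"
  using q by (simp add: q_int_def power_le_one)

lemma q_int_ge_1:
  assumes "n \<ge> 1"
  shows "q_int q n \<ge> 1"
proof -
  have "q_int q n = 1 + q * q_int q (n - 1)"
    using q_int_add[of q 1 "n - 1"] q assms by (simp add: q_int_def)
  then show ?thesis
    using q q_int_nonneg by simp
qed

lemma q_int_le: "q_int q n \<le> 1 / (1 - q)"
  using q by (simp add: q_int_def divide_right_mono)

lemma q_base_0: "q_base q 0 = 0"
  by (simp add: q_base_def q_int_def)

lemma q_base_pos: "n \<ge> 1 \<Longrightarrow> q_base q n > 0"
  using q q_int_ge_1[of n] by (simp add: q_base_def)

lemma q_base_nonneg: "q_base q n \<ge> 0"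
  using q q_int_nonneg by (simp add: q_base_def)

lemma q_base_le: "q_base q n \<le> q ^ n"
  using q q_int_ge_1[of n] q_base_0 by (cases n) (auto simp: q_base_def field_simps)

lemma sum_q_base_le: "(\<Sum>l=i..j. q_base q l) \<le> q ^ i / (1 - q)"
proof -
  have "(\<Sum>l=i..j. q_base q l) \<le> (\<Sum>l=i..j. q ^ l)"
    by (intro sum_mono q_base_le)
  also have "\<dots> \<le> q ^ i / (1 - q)"
    using q by (auto simp: sum_gp divide_right_mono)
  finally show ?thesis .
qed

lemma q_base_diff:
  assumes "m \<ge> 1"
  shows "q_base q m - q_base q (m + n) = q ^ m * q_int q n / (q_int q m * q_int q (m + n))"
proof -
  have "q_int q m > 0" "q_int q (m + n) > 0"
    using q_int_ge_1[of m] q_int_ge_1[of "m + n"] assms by auto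
  then have "q_base q m - q_base q (m + n) =
      q ^ m * (q_int q (n + m) - q ^ n * q_int q m) / (q_int q m * q_int q (m + n))"
    by (simp add: q_base_def field_simps power_add)
  then show ?thesis
    by (simp add: q_int_add[of q n m])
qed

lemma q_base_mult:
  assumes "m \<ge> 1" "n \<ge> 1"
  shows "q_base q m * q_base q (m + n) = q ^ m * q_base q n * (q_base q m - q_base q (m + n))"
  using q_int_ge_1[OF assms(2)] by (simp add: q_base_diff[OF assms(1)]) (simp add: q_base_def power_add)

lemma q_base_div_power:
  assumes "n \<ge> 1"
  shows "q_base q n / q ^ n = q_base q n + (1 - q)"
  using q q_int_ge_1[OF assms] by (simp add: q_base_def q_int_def field_simps)

lemma q_base_antimono:
  assumes "1 \<le> m" "m \<le> n"
  shows "q_base q n \<le> q_base q m"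
proof -
  have "q_base q m - q_base q n = q ^ m * q_int q (n - m) / (q_int q m * q_int q n)"
    using q_base_diff[OF assms(1), of "n - m"] assms(2) by simp
  also have "\<dots> \<ge> 0"
    using q q_int_nonneg by simp
  finally show ?thesis by simp
qed

lemma q_term_eq_powr:
  assumes "n \<ge> 1"
  shows "q_term q n s = of_real (q_base q n) powr s / of_real (q ^ n)"
proof -
  have "q_int q n > 0"
    using q_int_ge_1[OF assms] by simp
  then have "q_base q n > 0" and ln: "ln (q_base q n) = of_nat n * ln q - ln (q_int q n)"
    using q by (simp_all add: q_base_def ln_div ln_realpow)
  have "complex_of_real (q ^ n) = exp (of_real (of_nat n * ln q))"
    using q by (simp add: exp_of_nat_mult exp_of_real)
  then show ?thesis
    using q \<open>q_int q n > 0\<close> \<open>q_base q n > 0\<close>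
    by (simp add: q_term_def powr_def Ln_of_real ln algebra_simps flip: exp_diff del: of_real_power)
qed

lemma q_term_add_nat:
  assumes "n \<ge> 1"
  shows "q_term q n (s + of_nat k) = q_base q n ^ k *\<^sub>R q_term q n s"
  using q_base_pos[OF assms]
  by (simp add: q_term_eq_powr[OF assms] powr_add powr_nat scaleR_conv_of_real)

lemma q_term_diff_nat:
  assumes "n \<ge> 1"
  shows "q_term q n (s - of_nat k) = q_term q n s /\<^sub>R q_base q n ^ k"
  using q_term_add_nat[OF assms, of "s - of_nat k" k] q_base_pos[OF assms] by simp

lemma q_term_0:
  assumes "n \<ge> 1"
  shows "q_term q n 0 = of_real (1 / q ^ n)"
  using q_base_pos[OF assms] by (simp add: q_term_eq_powr[OF assms])

lemma norm_q_term_le: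
  assumes "n \<ge> 1"
  shows "norm (q_term q n s) \<le> (1 / (1 - q)) powr \<bar>Re s\<bar> * (q powr (Re s - 1)) ^ n"
proof -
  have int: "q_int q n \<ge> 1"
    by (rule q_int_ge_1[OF assms])
  have "norm (q_term q n s) = q powr ((Re s - 1) * real n) / q_int q n powr Re s"
    using q int by (simp add: q_term_def norm_divide norm_powr_real_powr)
  also have "q powr ((Re s - 1) * real n) = (q powr (Re s - 1)) ^ n"
    using q by (simp add: powr_powr[symmetric] powr_realpow)
  also have "(q powr (Re s - 1)) ^ n / q_int q n powr Re s =
      q_int q n powr (- Re s) * (q powr (Re s - 1)) ^ n"
    by (simp add: powr_minus field_simps)
  also have "q_int q n powr (- Re s) \<le> q_int q n powr \<bar>Re s\<bar>"
    using int by (intro powr_mono) auto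
  also have "q_int q n powr \<bar>Re s\<bar> \<le> (1 / (1 - q)) powr \<bar>Re s\<bar>"
    using int by (intro powr_mono2 q_int_le) auto
  finally show ?thesis
    by (simp add: mult_right_mono)
qed

lemma norm_q_prod_le:
  assumes "length ns = length ss" "\<And>n. n \<in> set ns \<Longrightarrow> n \<ge> 1"
  shows "norm (q_prod q ss ns) \<le> (\<Prod>s\<leftarrow>ss. (1 / (1 - q)) powr \<bar>Re s\<bar>) *
    prod_list (map2 power (map (\<lambda>s. q powr (Re s - 1)) ss) ns)"
  using assms
proof (induction ns ss rule: list_induct2)
  case (Cons n ns s ss)
  have "norm (q_prod q (s # ss) (n # ns)) = norm (q_term q n s) * norm (q_prod q ss ns)"
    by (simp add: q_prod_def norm_mult)
  also have "\<dots> \<le> ((1 / (1 - q)) powr \<bar>Re s\<bar> * (q powr (Re s - 1)) ^ n) *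
      ((\<Prod>s\<leftarrow>ss. (1 / (1 - q)) powr \<bar>Re s\<bar>) * prod_list (map2 power (map (\<lambda>s. q powr (Re s - 1)) ss) ns))"
    using Cons by (intro mult_mono norm_q_term_le) auto
  finally show ?case
    by (simp add: mult_ac)
qed (simp add: q_prod_def)

end

section \<open>Absolute convergence\<close>

text \<open>The domain of \<open>G\<^sub>q\<^bsup>(a,k+1)\<^esup>(s\<^sub>1, \<dots>, s\<^sub>a; s)\<close> is \<open>zeta_domain k [s\<^sub>1, \<dots>, s\<^sub>a, s]\<close>.\<close>

definition zeta_domain :: "nat \<Rightarrow> complex list \<Rightarrow> bool" where
  "zeta_domain k ss \<longleftrightarrow> (\<forall>j<length ss. Re (sum_list (drop j ss)) > real (length (drop j ss) + k))"

lemma zeta_domain_Nil [simp]: "zeta_domain k []"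
  by (simp add: zeta_domain_def)

lemma zeta_domain_Cons [simp]:
  "zeta_domain k (s # ss) \<longleftrightarrow> Re (s + sum_list ss) > real (Suc (length ss) + k) \<and> zeta_domain k ss"
  by (simp add: zeta_domain_def All_less_Suc2)

lemma zeta_domain_last: "zeta_domain k (ss @ [s]) \<Longrightarrow> Re s > real (Suc k)"
  by (induction ss) auto

lemma zeta_domain_split_last:
  assumes "zeta_domain (Suc k) (ss @ [s + s'])" and "Re s' > real (Suc k)"
  shows "zeta_domain k (ss @ [s, s'])"
  using assms by (induction ss) auto

lemma zeta_domain_shift_last:
  assumes "zeta_domain k (ss @ [s])"
  shows "zeta_domain 0 (ss @ [s - of_nat k])"
  using assms by (induction ss) auto

lemma abs_summable_on_q_prod:
  assumes q: "0 < q" "q < 1" and ss: "zeta_domain 0 ss"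
  shows "(\<lambda>ns. norm (q_prod q ss ns)) summable_on increasing_lists 0 (length ss)"
proof -
  define ratios where "ratios = map (\<lambda>s. q powr (Re s - 1)) ss"
  have prod: "(\<Prod>s\<leftarrow>us. q powr (Re s - 1)) = q powr (Re (sum_list us) - length us)" for us
    using q by (induction us) (simp_all add: powr_add[symmetric] algebra_simps)
  have "prod_list (drop j ratios) < 1" if "j < length ratios" for j
    using that q ss
    by (auto simp: ratios_def prod drop_map zeta_domain_def powr01_less_one simp del: length_drop)
  then have "\<exists>C. \<forall>N. ((\<lambda>ns. prod_list (map2 power ratios ns)) has_sum (C * prod_list ratios ^ N))
      (increasing_lists N (length ratios))"
    by (intro has_sum_geometric_increasing_lists) (auto simp: ratios_def)
  moreover have "length ratios = length ss"
    by (simp add: ratios_def)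
  ultimately have "(\<lambda>ns. prod_list (map2 power ratios ns)) summable_on increasing_lists 0 (length ss)"
    by (metis has_sum_imp_summable)
  then have "(\<lambda>ns. (\<Prod>s\<leftarrow>ss. (1 / (1 - q)) powr \<bar>Re s\<bar>) * prod_list (map2 power ratios ns))
      summable_on increasing_lists 0 (length ss)"
    by (rule summable_on_cmult_right)
  then show ?thesis
  proof (rule Infinite_Sum.abs_summable_on_comparison_test')
    show "norm (q_prod q ss ns) \<le> (\<Prod>s\<leftarrow>ss. (1 / (1 - q)) powr \<bar>Re s\<bar>) * prod_list (map2 power ratios ns)"
      if "ns \<in> increasing_lists 0 (length ss)" for ns
      unfolding ratios_def using that q by (intro norm_q_prod_le) (auto simp: increasing_lists_def Suc_le_eq)
  qed
qed

lemma abs_summable_on_q_prod_snoc: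
  assumes "0 < q" "q < 1" "zeta_domain 0 (ss @ [t])"
  shows "(\<lambda>(ns, m). norm (q_prod q ss ns * q_term q m t)) summable_on
    (SIGMA ns:increasing_lists 0 (length ss). {last (0 # ns)<..})"
proof -
  have "(\<lambda>ns. norm (q_prod q (ss @ [t]) ns)) summable_on increasing_lists 0 (Suc (length ss))"
    using abs_summable_on_q_prod[OF assms] by simp
  then have "(\<lambda>(ns, m). norm (q_prod q (ss @ [t]) (ns @ [m]))) summable_on
      (SIGMA ns:increasing_lists 0 (length ss). {last (0 # ns)<..})"
    by (subst (asm) summable_on_reindex_bij_betw[OF bij_betw_increasing_lists_snoc, symmetric])
      (simp add: case_prod_unfold)
  also have "?this \<longleftrightarrow> ?thesis"
    by (intro summable_on_cong) (auto simp: q_prod_snoc length_increasing_lists)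
  finally show ?thesis .
qed

section \<open>The series over \<open>n\<close>\<close>

text \<open>At the two largest indices \<open>m < M\<close>, the first series of the recursion multiplies the summand at \<open>m\<close>
  by \<open>lower_kernel\<close> and the second one the summand at \<open>M\<close> by \<open>upper_kernel\<close>.\<close>

definition lower_kernel :: "real \<Rightarrow> nat \<Rightarrow> nat \<Rightarrow> nat \<Rightarrow> real" where
  "lower_kernel q m M n = q_base q M ^ (n + 2) / q_base q m ^ Suc n / q ^ M"

definition upper_kernel :: "real \<Rightarrow> nat \<Rightarrow> nat \<Rightarrow> nat \<Rightarrow> real" where
  "upper_kernel q m M n = q_base q M ^ Suc n / q_base q m ^ n / q ^ m"

context
  fixes q :: real
  assumes q: "0 < q" "q < 1"
begin

lemma lower_kernel_nonneg: "lower_kernel q m M n \<ge> 0"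
  using q q_base_nonneg[OF q] by (simp add: lower_kernel_def)

lemma upper_kernel_nonneg: "upper_kernel q m M n \<ge> 0"
  using q q_base_nonneg[OF q] by (simp add: upper_kernel_def)

lemma q_term_mult_eq_lower_kernel:
  assumes "m \<ge> 1" "M \<ge> 1"
  shows "q_term q m (t - of_nat (Suc n)) * q_term q M (of_nat (n + 2)) =
    lower_kernel q m M n *\<^sub>R q_term q m t"
  using q_term_add_nat[OF q assms(2), of 0 "n + 2"] q_term_diff_nat[OF q assms(1), of t "Suc n"]
  by (simp add: q_term_0[OF q assms(2)] lower_kernel_def scaleR_conv_of_real divide_inverse)

lemma q_term_mult_eq_upper_kernel:
  assumes "m \<ge> 1" "M \<ge> 1"
  shows "q_term q m (- of_nat n) * q_term q M (t + of_nat (Suc n)) =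
    upper_kernel q m M n *\<^sub>R q_term q M t"
  using q_term_add_nat[OF q assms(2), of t "Suc n"] q_term_diff_nat[OF q assms(1), of 0 n]
  by (simp add: q_term_0[OF q assms(1)] upper_kernel_def scaleR_conv_of_real divide_inverse)

lemma upper_kernel_sums:
  assumes "1 \<le> m" "m < M"
  shows "upper_kernel q m M sums q_base q (M - m)"
proof -
  define r where "r = q_base q M / q_base q m"
  obtain d where M: "M = m + d" and "d \<ge> 1"
    using assms(2) by (metis less_imp_add_positive One_nat_def Suc_leI)
  have mult: "q_base q m * q_base q M = q ^ m * q_base q d * (q_base q m - q_base q M)"
    unfolding M by (rule q_base_mult[OF q assms(1) \<open>d \<ge> 1\<close>])
  have pos: "q_base q m > 0" "q_base q M > 0" "q_base q d > 0"
    using assms \<open>d \<ge> 1\<close> q_base_pos[OF q] by auto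
  with mult q have less: "q_base q M < q_base q m"
    by (metis diff_gt_0_iff_gt mult_pos_pos zero_less_mult_pos zero_less_power)
  then have "(\<lambda>n. q_base q M / q ^ m * r ^ n) sums (q_base q M / q ^ m * (1 / (1 - r)))"
    using pos by (intro sums_mult geometric_sums) (simp add: r_def)
  also have "(\<lambda>n. q_base q M / q ^ m * r ^ n) = upper_kernel q m M"
    by (simp add: fun_eq_iff upper_kernel_def r_def power_divide)
  also have "q_base q M / q ^ m * (1 / (1 - r)) = q_base q d"
    using less pos mult q by (simp add: r_def field_simps)
  finally show ?thesis by (simp add: M)
qed

lemma lower_kernel_sums:
  assumes "1 \<le> m" "m < M"
  shows "lower_kernel q m M sums (q_base q (M - m) - q_base q M)"
proof -
  have "(\<lambda>n. upper_kernel q m M (Suc n)) sums (q_base q (M - m) - upper_kernel q m M 0)"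
    using upper_kernel_sums[OF assms] by (subst sums_Suc_iff) simp
  then have "(\<lambda>n. q ^ m / q ^ M * upper_kernel q m M (Suc n)) sums
      (q ^ m / q ^ M * (q_base q (M - m) - upper_kernel q m M 0))"
    by (rule sums_mult)
  also have "(\<lambda>n. q ^ m / q ^ M * upper_kernel q m M (Suc n)) = lower_kernel q m M"
    using q by (simp add: fun_eq_iff upper_kernel_def lower_kernel_def)
  also have "q ^ m / q ^ M * (q_base q (M - m) - upper_kernel q m M 0) =
      q_base q (M - m) / q ^ (M - m) - q_base q M / q ^ M"
    using assms q by (simp add: upper_kernel_def power_diff right_diff_distrib)
  also have "\<dots> = q_base q (M - m) - q_base q M"
    using assms by (simp add: q_base_div_power[OF q])
  finally show ?thesis .
qed

lemma q_hom_nonneg: "q_hom q k i j \<ge> 0"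
  by (intro complete_hom_nonneg q_base_nonneg[OF q])

lemma q_hom_le: "q_hom q k i j \<le> (q ^ i / (1 - q)) ^ k"
proof -
  have "q_hom q k i j \<le> (\<Sum>l=i..j. q_base q l) ^ k"
    by (intro complete_hom_le_sum_power q_base_nonneg[OF q])
  also have "\<dots> \<le> (q ^ i / (1 - q)) ^ k"
    by (intro power_mono sum_q_base_le[OF q] sum_nonneg q_base_nonneg[OF q])
  finally show ?thesis .
qed

lemma q_hom_le_const: "q_hom q k i j \<le> (1 / (1 - q)) ^ k"
proof -
  have "(q ^ i / (1 - q)) ^ k \<le> (1 / (1 - q)) ^ k"
    using q by (intro power_mono divide_right_mono) (auto intro: power_le_one)
  with q_hom_le[of k i j] show ?thesis by linarith
qed

lemma q_hom_tendsto_0: "(\<lambda>n. q_hom q (Suc k) (Suc n) (n + m)) \<longlonglongrightarrow> 0"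
proof (rule tendsto_sandwich[of "\<lambda>_. 0" _ _ "\<lambda>n. (q ^ Suc n / (1 - q)) ^ Suc k"])
  have "(\<lambda>n. (q ^ n / (1 - q)) ^ Suc k) \<longlonglongrightarrow> (0 / (1 - q)) ^ Suc k"
    using q by (intro tendsto_intros LIMSEQ_realpow_zero) auto
  from LIMSEQ_Suc[OF this] show "(\<lambda>n. (q ^ Suc n / (1 - q)) ^ Suc k) \<longlonglongrightarrow> 0"
    by simp
qed (intro always_eventually allI q_hom_nonneg q_hom_le tendsto_const)+

lemma has_sum_q_hom_lower:
  "((\<lambda>M. (q_base q (M - m) - q_base q M) * q_hom q k (M - m) M) has_sum q_hom q (Suc k) 1 m) {m<..}"
proof -
  have "(\<lambda>n. q_hom q (Suc k) (Suc n) (n + m) - q_hom q (Suc k) (Suc (Suc n)) (Suc n + m)) sums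
      (q_hom q (Suc k) (Suc 0) (0 + m) - 0)"
    by (rule telescope_sums'[OF q_hom_tendsto_0])
  then have "(\<lambda>n. (q_base q (Suc n) - q_base q (Suc n + m)) * q_hom q k (Suc n) (Suc n + m))
      sums q_hom q (Suc k) 1 m"
    by (simp add: complete_hom_shift_diff)
  then have "((\<lambda>n. (q_base q (Suc n) - q_base q (Suc n + m)) * q_hom q k (Suc n) (Suc n + m)) has_sum
      q_hom q (Suc k) 1 m) UNIV"
    by (rule sums_nonneg_imp_has_sum)
      (intro mult_nonneg_nonneg q_hom_nonneg, simp add: q_base_antimono[OF q])
  also have "?this \<longleftrightarrow> ?thesis"
    by (rule has_sum_reindex_bij_witness[where i = "\<lambda>M. M - Suc m" and j = "\<lambda>n. Suc n + m"]) auto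
  finally show ?thesis .
qed

lemma sum_q_hom_upper:
  assumes "N < M"
  shows "(\<Sum>m\<in>{N<..<M}. q_base q (M - m) * q_hom q k (M - m) M) =
    q_hom q (Suc k) 1 M - q_hom q (Suc k) (M - N) M"
proof -
  have "(\<Sum>m\<in>{N<..<M}. q_base q (M - m) * q_hom q k (M - m) M) =
      (\<Sum>i\<in>{1..<M - N}. q_base q i * q_hom q k i M)"
    by (rule sum.reindex_bij_witness[where i = "\<lambda>i. M - i" and j = "\<lambda>m. M - m"]) auto
  also have "\<dots> = (\<Sum>i\<in>{1..<M - N}. q_hom q (Suc k) i M - q_hom q (Suc k) (Suc i) M)"
  proof (rule sum.cong)
    show "q_base q i * q_hom q k i M = q_hom q (Suc k) i M - q_hom q (Suc k) (Suc i) M"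
      if "i \<in> {1..<M - N}" for i
    proof -
      have "i \<le> M"
        using that by auto
      from complete_hom_lower[OF this, of "q_base q" k] show ?thesis by simp
    qed
  qed simp
  also have "\<dots> = q_hom q (Suc k) 1 M - q_hom q (Suc k) (M - N) M"
    using assms sum_Suc_diff'[of 1 "M - N" "\<lambda>i. - q_hom q (Suc k) i M"] by simp
  finally show ?thesis .
qed

end

section \<open>The recursion\<close>

text \<open>\<open>A\<close> indexes all summation variables but the largest, \<open>W\<close> collects their summands and \<open>N\<close> is the
  largest of them.\<close>

definition chain_sum ::
    "real \<Rightarrow> nat \<Rightarrow> 'a set \<Rightarrow> ('a \<Rightarrow> complex) \<Rightarrow> ('a \<Rightarrow> nat) \<Rightarrow> complex \<Rightarrow> complex" where
  "chain_sum q k A W N t = (\<Sum>\<^sub>\<infinity>(x, m)\<in>(SIGMA x:A. {N x<..}).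
    q_hom q k (m - N x) m *\<^sub>R (W x * q_term q m t))"

lemma chain_sum_cong:
  assumes "\<And>x. x \<in> A \<Longrightarrow> W x = W' x" "\<And>x. x \<in> A \<Longrightarrow> N x = N' x"
  shows "chain_sum q k A W N t = chain_sum q k A W' N' t"
  unfolding chain_sum_def using assms by (intro infsum_cong_neutral) auto

lemma chain_sum_reindex_bij_betw:
  assumes "bij_betw f B A"
  shows "chain_sum q k B (\<lambda>y. W (f y)) (\<lambda>y. N (f y)) t = chain_sum q k A W N t"
proof -
  have "bij_betw (\<lambda>(y, m). (f y, m)) (SIGMA y:B. {N (f y)<..}) (SIGMA x:A. {N x<..})"
    using assms by (auto simp: bij_betw_def inj_on_def)
  then show ?thesis
    unfolding chain_sum_def
    by (subst infsum_reindex_bij_betw[symmetric]) (auto simp: case_prod_unfold)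
qed

context
  fixes q :: real and A :: "'a set" and W :: "'a \<Rightarrow> complex" and N :: "'a \<Rightarrow> nat" and t :: complex
  assumes q: "0 < q" "q < 1"
begin

private abbreviation (input) chains :: "('a \<times> nat) set" where
  "chains \<equiv> (SIGMA x:A. {N x<..})"

private abbreviation (input) summand :: "'a \<times> nat \<Rightarrow> complex" where
  "summand \<equiv> \<lambda>y. W (fst y) * q_term q (snd y) t"

lemma chain_sum_eq_infsum_lower_kernel:
  "chain_sum q k chains (\<lambda>(x, m). W x * q_term q m (t - of_nat (Suc n))) snd (of_nat (n + 2)) =
    (\<Sum>\<^sub>\<infinity>(y, M)\<in>(SIGMA y:chains. {snd y<..}).
      (lower_kernel q (snd y) M n * q_hom q k (M - snd y) M) *\<^sub>R summand y)"
  unfolding chain_sum_def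
proof (rule infsum_cong)
  fix z assume "z \<in> (SIGMA y:chains. {snd y<..})"
  then obtain x m M where z: "z = ((x, m), M)" and "m \<ge> 1" "M \<ge> 1"
    by (auto simp: Suc_le_eq)
  from q_term_mult_eq_lower_kernel[OF q this(2,3), of t n]
  show "(case z of (y, M) \<Rightarrow> q_hom q k (M - snd y) M *\<^sub>R
      ((case y of (x, m) \<Rightarrow> W x * q_term q m (t - of_nat (Suc n))) * q_term q M (of_nat (n + 2)))) =
    (case z of (y, M) \<Rightarrow> (lower_kernel q (snd y) M n * q_hom q k (M - snd y) M) *\<^sub>R summand y)"
    by (simp only: z prod.case fst_conv snd_conv mult.assoc mult_scaleR_right scaleR_scaleR
        mult.commute[of "lower_kernel q m M n"])
qed

lemma chain_sum_eq_infsum_upper_kernel: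
  "chain_sum q k chains (\<lambda>(x, m). W x * q_term q m (- of_nat n)) snd (t + of_nat (Suc n)) =
    (\<Sum>\<^sub>\<infinity>(y, m)\<in>(SIGMA y:chains. {N (fst y)<..<snd y}).
      (upper_kernel q m (snd y) n * q_hom q k (snd y - m) (snd y)) *\<^sub>R summand y)"
  unfolding chain_sum_def
proof (rule infsum_reindex_bij_witness[symmetric,
      where i = "\<lambda>z. ((fst (fst z), snd z), snd (fst z))"
      and j = "\<lambda>z. ((fst (fst z), snd z), snd (fst z))"])
  fix z assume "z \<in> (SIGMA y:chains. {N (fst y)<..<snd y})"
  then obtain x m M where z: "z = ((x, M), m)" and "m \<ge> 1" "M \<ge> 1"
    by (auto simp: Suc_le_eq)
  from q_term_mult_eq_upper_kernel[OF q this(2,3), of n t]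
  show "(case ((fst (fst z), snd z), snd (fst z)) of (y, M) \<Rightarrow> q_hom q k (M - snd y) M *\<^sub>R
      ((case y of (x, m) \<Rightarrow> W x * q_term q m (- of_nat n)) * q_term q M (t + of_nat (Suc n)))) =
    (case z of (y, m) \<Rightarrow> (upper_kernel q m (snd y) n * q_hom q k (snd y - m) (snd y)) *\<^sub>R summand y)"
    by (simp only: z prod.case fst_conv snd_conv mult.assoc mult_scaleR_right scaleR_scaleR
        mult.commute[of "upper_kernel q m M n"])
qed auto

context
  assumes summable: "(\<lambda>(x, m). norm (W x * q_term q m t)) summable_on (SIGMA x:A. {N x<..})"
begin

lemma abs_summable_on_chains_scaleR:
  assumes "\<And>y. y \<in> chains \<Longrightarrow> 0 \<le> g y \<and> g y \<le> C"
  shows "(\<lambda>y. norm (g y *\<^sub>R summand y)) summable_on chains"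
  using summable assms
  by (intro abs_summable_on_scaleR_bounded[where C = C]) (auto simp: case_prod_unfold)

lemma chain_sum_lower_sums:
  "(\<lambda>n. chain_sum q k chains (\<lambda>(x, m). W x * q_term q m (t - of_nat (Suc n))) snd (of_nat (n + 2)))
    sums (\<Sum>\<^sub>\<infinity>y\<in>chains. q_hom q (Suc k) 1 (snd y) *\<^sub>R summand y)"
  unfolding chain_sum_eq_infsum_lower_kernel
proof (rule sums_infsum_Sigma_scaleR)
  show "(\<lambda>n. lower_kernel q (snd y) M n * q_hom q k (M - snd y) M) sums
      ((q_base q (M - snd y) - q_base q M) * q_hom q k (M - snd y) M)"
    if "y \<in> chains" "M \<in> {snd y<..}" for y M
    using that by (intro sums_mult2 lower_kernel_sums[OF q]) auto
  show "((\<lambda>M. (q_base q (M - snd y) - q_base q M) * q_hom q k (M - snd y) M) has_sum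
      q_hom q (Suc k) 1 (snd y)) {snd y<..}" for y :: "'a \<times> nat"
    by (rule has_sum_q_hom_lower[OF q])
  show "(\<lambda>y. norm (q_hom q (Suc k) 1 (snd y) *\<^sub>R summand y)) summable_on chains"
    using q_hom_nonneg[OF q] q_hom_le_const[OF q]
    by (intro abs_summable_on_chains_scaleR) blast
qed (intro mult_nonneg_nonneg lower_kernel_nonneg[OF q] q_hom_nonneg[OF q])

lemma chain_sum_upper_sums:
  "(\<lambda>n. chain_sum q k chains (\<lambda>(x, m). W x * q_term q m (- of_nat n)) snd (t + of_nat (Suc n)))
    sums (\<Sum>\<^sub>\<infinity>y\<in>chains.
      (q_hom q (Suc k) 1 (snd y) - q_hom q (Suc k) (snd y - N (fst y)) (snd y)) *\<^sub>R summand y)"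
  unfolding chain_sum_eq_infsum_upper_kernel
proof -
  let ?g = "\<lambda>y. q_hom q (Suc k) 1 (snd y) - q_hom q (Suc k) (snd y - N (fst y)) (snd y)"
  have inner: "((\<lambda>m. q_base q (snd y - m) * q_hom q k (snd y - m) (snd y)) has_sum ?g y)
      {N (fst y)<..<snd y}" if "y \<in> chains" for y
    using that sum_q_hom_upper[OF q, of "N (fst y)" "snd y" k] by (intro has_sum_finiteI) auto
  show "(\<lambda>n. \<Sum>\<^sub>\<infinity>(y, m)\<in>(SIGMA y:chains. {N (fst y)<..<snd y}).
      (upper_kernel q m (snd y) n * q_hom q k (snd y - m) (snd y)) *\<^sub>R summand y)
    sums (\<Sum>\<^sub>\<infinity>y\<in>chains. ?g y *\<^sub>R summand y)"
  proof (rule sums_infsum_Sigma_scaleR[OF _ _ inner])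
    show "(\<lambda>n. upper_kernel q m (snd y) n * q_hom q k (snd y - m) (snd y)) sums
        (q_base q (snd y - m) * q_hom q k (snd y - m) (snd y))"
      if "y \<in> chains" "m \<in> {N (fst y)<..<snd y}" for y m
      using that by (intro sums_mult2 upper_kernel_sums[OF q]) auto
    have "0 \<le> ?g y" if "y \<in> chains" for y
      using q_base_nonneg[OF q] q_hom_nonneg[OF q]
      by (intro has_sum_nonneg[OF inner[OF that]]) simp
    moreover have "?g y \<le> (1 / (1 - q)) ^ Suc k" for y
      using q_hom_le_const[OF q, of "Suc k" 1 "snd y"]
        q_hom_nonneg[OF q, of "Suc k" "snd y - N (fst y)" "snd y"] by linarith
    ultimately show "(\<lambda>y. norm (?g y *\<^sub>R summand y)) summable_on chains"
      by (intro abs_summable_on_chains_scaleR) blast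
  qed (intro mult_nonneg_nonneg upper_kernel_nonneg[OF q] q_hom_nonneg[OF q])
qed

lemma chain_sum_Suc:
  "chain_sum q (Suc k) A W N t =
    (\<Sum>n. chain_sum q k chains (\<lambda>(x, m). W x * q_term q m (t - of_nat (Suc n))) snd (of_nat (n + 2))) -
    (\<Sum>n. chain_sum q k chains (\<lambda>(x, m). W x * q_term q m (- of_nat n)) snd (t + of_nat (Suc n)))"
proof -
  let ?full = "\<lambda>y. q_hom q (Suc k) 1 (snd y) *\<^sub>R summand y"
  let ?gap = "\<lambda>y. q_hom q (Suc k) (snd y - N (fst y)) (snd y) *\<^sub>R summand y"
  have q_hom_summable: "(\<lambda>y. q_hom q (Suc k) (i y) (j y) *\<^sub>R summand y) summable_on chains" for i j
    using q_hom_nonneg[OF q] q_hom_le_const[OF q]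
    by (intro abs_summable_summable[OF abs_summable_on_chains_scaleR]) blast
  have full: "?full summable_on chains" and gap: "?gap summable_on chains"
    by (rule q_hom_summable)+
  have "(\<Sum>\<^sub>\<infinity>y\<in>chains.
      (q_hom q (Suc k) 1 (snd y) - q_hom q (Suc k) (snd y - N (fst y)) (snd y)) *\<^sub>R summand y) =
      infsum ?full chains - infsum ?gap chains"
    using infsumI[OF has_sum_add[OF has_sum_infsum[OF full] has_sum_uminusI[OF has_sum_infsum[OF gap]]]]
    by (simp only: scaleR_diff_left flip: diff_conv_add_uminus)
  moreover have "chain_sum q (Suc k) A W N t = infsum ?gap chains"
    by (simp add: chain_sum_def case_prod_unfold)
  ultimately show ?thesis
    unfolding sums_unique[OF chain_sum_lower_sums, symmetric]
      sums_unique[OF chain_sum_upper_sums, symmetric]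
    by simp
qed

end

end

definition list_chain_sum :: "real \<Rightarrow> nat \<Rightarrow> complex list \<Rightarrow> complex \<Rightarrow> complex" where
  "list_chain_sum q k ss t =
    chain_sum q k (increasing_lists 0 (length ss)) (q_prod q ss) (\<lambda>ns. last (0 # ns)) t"

lemma zeta_q_snoc_eq_list_chain_sum: "zeta_q q (ss @ [s]) = list_chain_sum q 0 ss s"
proof -
  have "zeta_q q (ss @ [s]) = (\<Sum>\<^sub>\<infinity>ns\<in>increasing_lists 0 (Suc (length ss)). q_prod q (ss @ [s]) ns)"
    by (simp add: zeta_q_eq_infsum_q_prod)
  also have "\<dots> = list_chain_sum q 0 ss s"
    unfolding list_chain_sum_def chain_sum_def
    by (subst infsum_reindex_bij_betw[OF bij_betw_increasing_lists_snoc, symmetric])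
      (auto intro!: infsum_cong simp: q_prod_snoc length_increasing_lists)
  finally show ?thesis .
qed

lemma list_chain_sum_snoc:
  "list_chain_sum q k (ss @ [s]) t =
    chain_sum q k (SIGMA ns:increasing_lists 0 (length ss). {last (0 # ns)<..})
      (\<lambda>(ns, m). q_prod q ss ns * q_term q m s) snd t"
  unfolding list_chain_sum_def length_append_singleton
  by (subst chain_sum_reindex_bij_betw[OF bij_betw_increasing_lists_snoc, symmetric])
    (auto intro!: chain_sum_cong simp: q_prod_snoc length_increasing_lists)

lemma list_chain_sum_Suc:
  assumes "0 < q" "q < 1" "zeta_domain 0 (ss @ [t])"
  shows "list_chain_sum q (Suc k) ss t =
    (\<Sum>n. list_chain_sum q k (ss @ [t - of_nat (Suc n)]) (of_nat (n + 2))) -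
    (\<Sum>n. list_chain_sum q k (ss @ [- of_nat n]) (t + of_nat (Suc n)))"
  unfolding list_chain_sum_snoc unfolding list_chain_sum_def
  by (rule chain_sum_Suc[OF assms(1,2) abs_summable_on_q_prod_snoc[OF assms]])

lemma list_chain_sum_Nil:
  assumes "0 < q" "q < 1"
  shows "list_chain_sum q k [] (s - of_nat k) = list_chain_sum q 0 [] s"
  unfolding list_chain_sum_def chain_sum_def
proof (rule infsum_cong)
  fix z assume "z \<in> (SIGMA ns:increasing_lists 0 (length ([] :: complex list)). {last (0 # ns)<..})"
  then obtain m where z: "z = ([], m)" and "m \<ge> 1"
    by (auto simp: increasing_lists_0)
  from q_term_add_nat[OF assms this(2), of "s - of_nat k" k]
  show "(case z of (ns, m) \<Rightarrow> q_hom q k (m - last (0 # ns)) m *\<^sub>R (q_prod q [] ns * q_term q m (s - of_nat k))) =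
      (case z of (ns, m) \<Rightarrow> q_hom q 0 (m - last (0 # ns)) m *\<^sub>R (q_prod q [] ns * q_term q m s))"
    by (simp add: z complete_hom_singleton)
qed

lemma G_q_eq_list_chain_sum:
  assumes q: "0 < q" "q < 1" and domain: "zeta_domain k (ss @ [s])"
  shows "G_q q (Suc k) ss s = list_chain_sum q k ss (s - of_nat k)"
  using domain
proof (induction k arbitrary: ss s)
  case 0
  show ?case by (simp add: zeta_q_snoc_eq_list_chain_sum)
next
  case (Suc k)
  define t where "t = s - of_nat (Suc k)"
  have hyp: "G_q q (Suc k) (ss @ [r]) r' = list_chain_sum q k (ss @ [r]) (r' - of_nat k)"
    if "s = r + r'" "Re r' > real (Suc k)" for r r'
    using Suc.IH[of "ss @ [r]" r'] zeta_domain_split_last[of k ss r r'] Suc.prems that by simp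
  have "G_q q (Suc k) (ss @ [s - of_nat n - of_nat (Suc (Suc k))]) (of_nat n + of_nat (Suc (Suc k))) =
      list_chain_sum q k (ss @ [t - of_nat (Suc n)]) (of_nat (n + 2))" for n
    using hyp[of "s - of_nat n - of_nat (Suc (Suc k))" "of_nat n + of_nat (Suc (Suc k))"]
    by (simp add: t_def algebra_simps)
  moreover have "G_q q (Suc k) (ss @ [- of_nat n]) (s + of_nat n) =
      list_chain_sum q k (ss @ [- of_nat n]) (t + of_nat (Suc n))" for n
    using hyp[of "- of_nat n" "s + of_nat n"] zeta_domain_last[OF Suc.prems]
    by (simp add: t_def algebra_simps)
  moreover have "zeta_domain 0 (ss @ [t])"
    unfolding t_def using Suc.prems by (rule zeta_domain_shift_last)
  ultimately show ?case
    unfolding t_def[symmetric] by (simp only: G_q.simps list_chain_sum_Suc[OF q])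
qed

theorem theorem4:
  fixes q :: real and b :: nat and s :: complex
  assumes "0 < q" and "q < 1" and "b \<ge> 1" and "Re s > real b"
  shows "G_q q b [] s = zeta_q q [s]"
proof -
  obtain k where b: "b = Suc k"
    using \<open>b \<ge> 1\<close> by (cases b) auto
  have "G_q q b [] s = list_chain_sum q k [] (s - of_nat k)"
    using G_q_eq_list_chain_sum[of q k "[]" s] assms by (simp add: b)
  also have "\<dots> = list_chain_sum q 0 [] s"
    using assms(1,2) by (rule list_chain_sum_Nil)
  also have "\<dots> = zeta_q q [s]"
    using zeta_q_snoc_eq_list_chain_sum[of q "[]" s] by simp
  finally show ?thesis .
qed

end
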